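(* Let $F : [0,\infty) \to \mathbb{R}$ be a function. Then $F$, applied entrywise, maps $\mathcal{M}([0,1])$ into itself if and only if $F$ is absolutely monotonic on $(0,\infty)$ (so non-decreasing there) and $0 \leq F(0) \leq \lim_{\epsilon \to 0^+} F(\epsilon)$.
   Context: An admissible measure is a non-negative measure $\mu$ on $\mathbb{R}$ possessing moments of all orders; its moments are $s_k(\mu) := \int_{\mathbb{R}} x^k \, d\mu$ ($k \geq 0$), where $s_0(\mu)$ is the total mass, and its moment sequence is $\mathbf{s}(\mu) := (s_k(\mu))_{k \geq 0}$. For $K \subset \mathbb{R}$, $\mathcal{M}(K)$ denotes the set of moment sequences of admissible measures supported on $K$. A function $F$ acts entrywise on a sequence by $F[(s_k)_{k\geq 0}] := (F(s_k))_{k \geq 0}$. A function is absolutely monotonic on an open interval if it is smooth there and all its derivatives of order $k \geq 0$ are non-negative there. *)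

theory Defs
  imports "HOL-Analysis.Analysis"
begin

text \<open>Integrability of \<open>x ^ 0 = 1\<close> makes every admissible measure finite.\<close>

definition admissible_measure :: "real measure \<Rightarrow> bool" where
  "admissible_measure M \<longleftrightarrow> sets M = sets borel \<and> (\<forall>k::nat. integrable M (\<lambda>x. x ^ k))"

definition moment :: "real measure \<Rightarrow> nat \<Rightarrow> real" where
  "moment M k = (\<integral>x. x ^ k \<partial>M)"

text \<open>A measure is supported on \<open>K\<close> if it gives no mass to the complement of \<open>K\<close>;
  for closed \<open>K\<close> this says that the topological support is contained in \<open>K\<close>.
  The zero measure is allowed.\<close>

definition moment_sequences :: "real set \<Rightarrow> (nat \<Rightarrow> real) set" where
  "moment_sequences K = {moment M | M. admissible_measure M \<and> (AE x in M. x \<in> K)}"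

definition entrywise :: "(real \<Rightarrow> real) \<Rightarrow> (nat \<Rightarrow> real) \<Rightarrow> (nat \<Rightarrow> real)" where
  "entrywise F s = (\<lambda>k. F (s k))"

text \<open>The following two notions are meant for open \<open>I\<close>; they then depend only on the
  restriction of \<open>f\<close> to \<open>I\<close>, since derivatives are local.\<close>

definition smooth_on_open :: "real set \<Rightarrow> (real \<Rightarrow> real) \<Rightarrow> bool" where
  "smooth_on_open I f \<longleftrightarrow> (\<forall>k. \<forall>x\<in>I. ((deriv ^^ k) f) differentiable (at x))"

definition absolutely_monotonic_on :: "real set \<Rightarrow> (real \<Rightarrow> real) \<Rightarrow> bool" where
  "absolutely_monotonic_on I f \<longleftrightarrow>
     smooth_on_open I f \<and> (\<forall>k. \<forall>x\<in>I. 0 \<le> (deriv ^^ k) f x)"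

end

theory Submission
  imports Defs "HOL-Probability.Probability"
begin

text \<open>
  If \<open>F\<close> is absolutely monotonic on \<open>(0,\<infinity>)\<close>, then by Bernstein it is there the sum of a power
  series with non-negative coefficients (\<open>absolutely_monotonic_power_series\<close>). Moment sequences
  on \<open>[0,1]\<close> are closed under products, because the interval is closed under multiplication and the
  image of a product measure under multiplication has the products of the moments as its moments
  (\<open>moment_sequences_times\<close>), and under countable mixtures (\<open>moment_sequences_mixture\<close>). Hence the
  power series preserves every moment sequence without a zero entry. A moment vanishes only when
  the measure is concentrated at \<open>0\<close>; the sequence is then \<open>(c, 0, 0, \<dots>)\<close>, and here the
  condition on \<open>F 0\<close> enters, since \<open>(F c, F 0, F 0, \<dots>)\<close> belongs to point masses \<open>F 0\<close> at \<open>1\<close>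
  and \<open>F c - F 0\<close> at \<open>0\<close>.

  For the converse, measures with at most two atoms are enough. The only property of the image
  sequence \<open>t\<close> that is used is that \<open>\<Sum>i. p\<^sub>i t\<^sub>i \<ge> 0\<close> for every polynomial \<open>p = \<Sum>i. p\<^sub>i z\<^sup>i\<close> that is
  non-negative on \<open>[0,1]\<close>.

  \<^item> Smoothness. The moments of one atom form a geometric progression, so the polynomials
    \<open>(1 - z)\<^sup>m\<close> show that all forward differences of \<open>u \<mapsto> F (exp u)\<close> are non-negative, for every
    step and every order. The class of functions on the line with this property is closed under
    differentiation: its members are continuous and convex, the right derivative is a limit of
    difference quotients and therefore belongs to the class again, and being continuous it is a
    two-sided derivative (\<open>all_diffs_nonneg_derivative\<close>). So \<open>F \<circ> exp\<close>, and with it \<open>F\<close>, is smooth.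

  \<^item> Signs of the derivatives. For the moments \<open>a + h x\<^sup>k\<close> with small \<open>h\<close>, the Taylor expansion
    \<open>\<Sum>i. p\<^sub>i F (a + h x\<^sup>i) \<sim> \<Sum>j. p (x\<^sup>j) F\<^sup>(\<^sup>j\<^sup>) (a) h\<^sup>j / j!\<close> isolates a single derivative: a
    non-negative polynomial vanishing at \<open>1, x, \<dots>, x\<close> to the power \<open>N - 1\<close> leaves the \<open>N\<close>-th derivative
    as the leading term, which is thus non-negative (\<open>moment_preserver_deriv_nonneg\<close>).

  \<^item> The origin. The zero measure gives \<open>0 \<le> F 0\<close>, and one atom of mass \<open>c\<close> at \<open>0\<close> gives
    \<open>F 0 \<le> F c\<close>.
\<close>

section \<open>Limits of monotone functions at the left end point\<close>

lemma mono_on_tendsto_at_right_0: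
  fixes f :: "real \<Rightarrow> real"
  assumes mono: "mono_on {0<..} f" and nonneg: "\<And>x. 0 < x \<Longrightarrow> 0 \<le> f x"
  shows "\<exists>L\<ge>0. (f \<longlongrightarrow> L) (at_right 0) \<and> (\<forall>x>0. L \<le> f x)"
proof (intro exI conjI)
  let ?L = "Inf (f ` {0<..})"
  have bdd: "bdd_below (f ` {0<..})"
    using nonneg by (auto intro!: bdd_belowI[of _ 0])
  have lower: "?L \<le> f x" if "x > 0" for x
    using that bdd by (auto intro!: cInf_lower)
  show "0 \<le> ?L"
    using nonneg by (intro cInf_greatest) auto
  show "\<forall>x>0. ?L \<le> f x"
    using lower by blast
  show "(f \<longlongrightarrow> ?L) (at_right 0)"
  proof (rule order_tendstoI)
    fix a assume "a < ?L"
    have "eventually (\<lambda>x::real. 0 < x) (at_right 0)"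
      by (simp add: eventually_at_right_less)
    then show "eventually (\<lambda>x. a < f x) (at_right 0)"
      by eventually_elim (use lower \<open>a < ?L\<close> in force)
  next
    fix a assume "?L < a"
    then obtain y where y: "y > 0" "f y < a"
      by (subst (asm) cInf_less_iff[OF _ bdd]) auto
    have "f x < a" if "0 < x" "x < y" for x
      using mono_onD[OF mono, of x y] that y by auto
    then show "eventually (\<lambda>x. f x < a) (at_right 0)"
      using y eventually_at_right_real[of 0 y] by (auto elim: eventually_mono)
  qed
qed

section \<open>Moment sequences on the unit interval\<close>

lemma moment_sequences_unit_intervalE:
  assumes "s \<in> moment_sequences {0..1}"
  obtains M where "sets M = sets borel" "finite_measure M" "AE x in M. x \<in> {0..1}"
    "\<forall>k. integrable M (\<lambda>x. x ^ k)" "s = (\<lambda>k. \<integral>x. x ^ k \<partial>M)"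
proof -
  from assms obtain M where M: "sets M = sets borel" "\<And>k. integrable M (\<lambda>x. x ^ k)"
    "AE x in M. x \<in> {0..1}" "s = moment M"
    by (auto simp: moment_sequences_def admissible_measure_def)
  moreover have "finite_measure M"
  proof (rule finite_measureI)
    have "integrable M (\<lambda>x. 1 :: real)"
      using M(2)[of 0] by simp
    then show "emeasure M (space M) \<noteq> \<infinity>"
      by (simp add: integrable_iff_bounded less_top)
  qed
  ultimately show ?thesis
    by (intro that[of M]) (auto simp: moment_def)
qed

lemma moment_sequences_unit_intervalI:
  assumes M: "sets M = sets borel" "finite_measure M" "AE x in M. x \<in> {0..1}"
    and s: "\<And>k. s k = (\<integral>x. x ^ k \<partial>M)"
  shows "s \<in> moment_sequences {0..1}"
proof -
  interpret finite_measure M by fact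
  have [measurable_cong]: "sets M = sets borel" by fact
  have "integrable M (\<lambda>x. x ^ k)" for k
  proof (rule integrable_const_bound[of _ 1])
    show "AE x in M. norm (x ^ k) \<le> 1"
      using M(3) by eventually_elim (auto intro: power_le_one)
  qed measurable
  moreover have "s = moment M"
    by (auto simp: moment_def s)
  ultimately show ?thesis
    using M by (auto simp: moment_sequences_def admissible_measure_def)
qed

text \<open>The product of two independent variables in \<open>[0,1]\<close> stays in \<open>[0,1]\<close>, and its moments are
  the products of the moments.\<close>

lemma moment_sequences_times:
  assumes "s \<in> moment_sequences {0..1}" "t \<in> moment_sequences {0..1}"
  shows "(\<lambda>k. s k * t k) \<in> moment_sequences {0..1}"
proof -
  obtain M where M: "sets M = sets borel" "finite_measure M" "AE x in M. x \<in> {0..1}"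
    "\<forall>k. integrable M (\<lambda>x. x ^ k)" "s = (\<lambda>k. \<integral>x. x ^ k \<partial>M)"
    using assms(1) by (rule moment_sequences_unit_intervalE)
  obtain N where N: "sets N = sets borel" "finite_measure N" "AE x in N. x \<in> {0..1}"
    "\<forall>k. integrable N (\<lambda>x. x ^ k)" "t = (\<lambda>k. \<integral>x. x ^ k \<partial>N)"
    using assms(2) by (rule moment_sequences_unit_intervalE)
  interpret M: finite_measure M by fact
  interpret N: finite_measure N by fact
  interpret P: pair_sigma_finite M N ..
  have [measurable_cong]: "sets M = sets borel" "sets N = sets borel" by fact+
  let ?mult = "\<lambda>p. fst p * snd p :: real"
  have mult[measurable]: "?mult \<in> borel_measurable (M \<Otimes>\<^sub>M N)"
    by measurable
  show ?thesis
  proof (rule moment_sequences_unit_intervalI)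
    let ?D = "distr (M \<Otimes>\<^sub>M N) borel ?mult"
    show "sets ?D = sets borel"
      by simp
    show "finite_measure ?D"
      by (intro finite_measure.finite_measure_distr finite_measure_pair_measure mult M N)
    have "AE p in M \<Otimes>\<^sub>M N. ?mult p \<in> {0..1}"
    proof (rule P.AE_pair_measure)
      show "{p \<in> space (M \<Otimes>\<^sub>M N). ?mult p \<in> {0..1}} \<in> sets (M \<Otimes>\<^sub>M N)"
        by measurable
      show "AE x in M. AE y in N. ?mult (x, y) \<in> {0..1}"
        using M(3)
      proof eventually_elim
        case (elim x)
        show ?case
          using N(3) by eventually_elim (use elim in \<open>auto intro: mult_le_one\<close>)
      qed
    qed
    then show "AE x in ?D. x \<in> {0..1}"
      by (subst AE_distr_iff) auto
    fix k
    have "integrable (M \<Otimes>\<^sub>M N) (\<lambda>(x, y). x ^ k * y ^ k)"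
      using M(4) N(4)
      by (intro P.Fubini_integrable) (auto simp: abs_mult)
    then have "(\<integral>p. (case p of (x, y) \<Rightarrow> x ^ k * y ^ k) \<partial>(M \<Otimes>\<^sub>M N)) = s k * t k"
      using P.integral_fst[of "\<lambda>x y. x ^ k * y ^ k"] by (simp add: M(5) N(5))
    then show "s k * t k = (\<integral>x. x ^ k \<partial>?D)"
      by (subst integral_distr) (auto simp: power_mult_distrib case_prod_beta)
  qed
qed

lemma moment_sequences_point:
  assumes "x \<in> {0..1}"
  shows "(\<lambda>k. x ^ k) \<in> moment_sequences {0..1}"
proof (rule moment_sequences_unit_intervalI)
  show "finite_measure (return borel x)"
    by (intro prob_space.finite_measure prob_space_return) simp
  show "AE y in return borel x. y \<in> {0..1}"
    using assms by (subst AE_return) auto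
  show "x ^ k = (\<integral>y. y ^ k \<partial>return borel x)" for k
    by (subst integral_return) auto
qed simp

lemma moment_sequences_power:
  assumes "s \<in> moment_sequences {0..1}"
  shows "(\<lambda>k. s k ^ n) \<in> moment_sequences {0..1}"
proof (induction n)
  case 0
  show ?case
    using moment_sequences_point[of 1] by simp
next
  case (Suc n)
  with moment_sequences_times[OF assms] show ?case
    by simp
qed

lemma moment_sequences_scale:
  assumes "s \<in> moment_sequences {0..1}" "0 \<le> r"
  shows "(\<lambda>k. r * s k) \<in> moment_sequences {0..1}"
proof -
  obtain M where M: "sets M = sets borel" "finite_measure M" "AE x in M. x \<in> {0..1}"
    "\<forall>k. integrable M (\<lambda>x. x ^ k)" "s = (\<lambda>k. \<integral>x. x ^ k \<partial>M)"
    using assms(1) by (rule moment_sequences_unit_intervalE)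
  have [measurable_cong]: "sets M = sets borel" by fact
  show ?thesis
  proof (rule moment_sequences_unit_intervalI)
    let ?D = "density M (\<lambda>_. ennreal r)"
    show "sets ?D = sets borel"
      by (simp add: M)
    show "finite_measure ?D"
      using finite_measure.emeasure_finite[OF M(2)]
      by (intro finite_measureI) (auto simp: emeasure_density nn_integral_cmult ennreal_mult_eq_top_iff)
    show "AE x in ?D. x \<in> {0..1}"
      using M(3) by (subst AE_density) auto
    show "r * s k = (\<integral>x. x ^ k \<partial>?D)" for k
      using \<open>0 \<le> r\<close> by (subst integral_density) (auto simp: M(5))
  qed
qed

text \<open>The measure is the monadic bind of the weights, seen as a measure on the natural numbers,
  with the family of probability measures: choose an index, then a point. Normalising the
  family is what makes bind, which is set up for subprobability kernels, applicable.\<close>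

lemma moment_sequences_mixture:
  assumes t: "\<And>n. t n \<in> moment_sequences {0..1}" "\<And>n. t n 0 = 1"
    and b: "\<And>n. 0 \<le> b n" "summable b"
  shows "(\<lambda>k. \<Sum>n. b n * t n k) \<in> moment_sequences {0..1}"
proof -
  have "\<exists>M. sets M = sets borel \<and> prob_space M \<and> (AE x in M. x \<in> {0..1}) \<and>
      (\<forall>k. integrable M (\<lambda>x. x ^ k)) \<and> t n = (\<lambda>k. \<integral>x. x ^ k \<partial>M)" for n
  proof -
    obtain M where M: "sets M = sets borel" "finite_measure M" "AE x in M. x \<in> {0..1}"
      "\<forall>k. integrable M (\<lambda>x. x ^ k)" "t n = (\<lambda>k. \<integral>x. x ^ k \<partial>M)"
      using t(1)[of n] by (rule moment_sequences_unit_intervalE)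
    have "measure M (space M) = 1"
      using t(2)[of n] by (simp add: M(5))
    then have "prob_space M"
      by (intro prob_spaceI) (simp add: finite_measure.emeasure_eq_measure[OF M(2)])
    with M show ?thesis
      by blast
  qed
  then obtain M where M: "\<And>n. sets (M n) = sets borel" "\<And>n. prob_space (M n)"
    "\<And>n. AE x in M n. x \<in> {0..1}" "\<And>n k. integrable (M n) (\<lambda>x. x ^ k)"
    "\<And>n. t n = (\<lambda>k. \<integral>x. x ^ k \<partial>M n)"
    by metis
  define W where "W = density (count_space UNIV) (\<lambda>n. ennreal (b n))"
  have M_meas[measurable]: "M \<in> measurable W (subprob_algebra borel)"
    using M(1,2) by (auto simp: W_def space_subprob_algebra prob_space_imp_subprob_space)
  let ?B = "W \<bind> M"
  have sets_B[measurable_cong]: "sets ?B = sets borel"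
    using M(1) by (intro sets_bind) (auto simp: W_def)
  have AE_B: "AE x in ?B. x \<in> {0..1}"
    using M(3) by (subst AE_bind[OF M_meas]) auto
  have nn: "(\<integral>\<^sup>+x. f x \<partial>?B) = (\<Sum>n. ennreal (b n) * (\<integral>\<^sup>+x. f x \<partial>M n))"
    if "f \<in> borel_measurable borel" for f
    by (subst nn_integral_bind[OF that M_meas])
      (simp add: W_def nn_integral_density nn_integral_count_space_nat)
  have nn_moment: "(\<integral>\<^sup>+x. ennreal (x ^ k) \<partial>?B) = ennreal (\<Sum>n. b n * t n k)"
    "0 \<le> (\<Sum>n. b n * t n k)" for k
  proof -
    have nonneg: "0 \<le> t n k" for n
      unfolding M(5) using M(3)[of n] by (intro integral_nonneg_AE) (auto elim: eventually_mono)
    have "t n k \<le> t n 0" for n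
      unfolding M(5)
    proof (intro integral_mono_AE M(4))
      show "AE x in M n. x ^ k \<le> x ^ 0"
        using M(3)[of n] by eventually_elim (auto intro: power_le_one)
    qed
    then have le: "b n * t n k \<le> b n" for n
      using b(1)[of n] t(2)[of n] mult_left_le by metis
    have summable: "summable (\<lambda>n. b n * t n k)"
      using b(1) nonneg le by (intro summable_comparison_test'[OF b(2), of 0]) auto
    then show "0 \<le> (\<Sum>n. b n * t n k)"
      using b(1) nonneg by (intro suminf_nonneg) auto
    have "(\<integral>\<^sup>+x. ennreal (x ^ k) \<partial>M n) = ennreal (t n k)" for n
      unfolding M(5) using M(3)[of n]
      by (intro nn_integral_eq_integral M(4)) (auto elim: eventually_mono)
    then have "(\<integral>\<^sup>+x. ennreal (x ^ k) \<partial>?B) = (\<Sum>n. ennreal (b n * t n k))"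
      using b(1) nonneg by (subst nn) (auto simp: ennreal_mult)
    also have "\<dots> = ennreal (\<Sum>n. b n * t n k)"
      using b(1) nonneg summable by (intro suminf_ennreal2) auto
    finally show "(\<integral>\<^sup>+x. ennreal (x ^ k) \<partial>?B) = ennreal (\<Sum>n. b n * t n k)" .
  qed
  show ?thesis
  proof (rule moment_sequences_unit_intervalI[OF sets_B _ AE_B])
    show "finite_measure ?B"
      using nn_moment(1)[of 0] by (intro finite_measureI) simp
    show "(\<Sum>n. b n * t n k) = (\<integral>x. x ^ k \<partial>?B)" for k
      using AE_B nn_moment[of k]
      by (subst integral_eq_nn_integral) (auto elim: eventually_mono)
  qed
qed

lemma moment_sequences_two_points:
  assumes "0 \<le> a" "0 \<le> b" "x \<in> {0..1}"
  shows "(\<lambda>k. a + b * x ^ k) \<in> moment_sequences {0..1}"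
proof -
  define w where "w n = (if n = 0 then a else if n = 1 then b else 0)" for n :: nat
  define t where "t n = (if n = 0 then (\<lambda>k. 1 ^ k) else (\<lambda>k. x ^ k))" for n :: nat
  have "summable w"
    by (rule summable_finite[of "{0, 1}"]) (auto simp: w_def)
  moreover have "(\<Sum>n. w n * t n k) = a + b * x ^ k" for k
    by (subst suminf_finite[of "{0, 1}"]) (auto simp: w_def t_def)
  moreover have "t n \<in> moment_sequences {0..1}" for n
    using moment_sequences_point[of 1] moment_sequences_point[OF assms(3)] by (auto simp: t_def)
  ultimately show ?thesis
    using moment_sequences_mixture[of t w] assms by (simp add: w_def t_def)
qed

lemma moment_sequences_nonneg:
  assumes "s \<in> moment_sequences {0..1}"
  shows "0 \<le> s k"
proof -
  obtain M where M: "sets M = sets borel" "finite_measure M" "AE x in M. x \<in> {0..1}"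
    "\<forall>k. integrable M (\<lambda>x. x ^ k)" "s = (\<lambda>k. \<integral>x. x ^ k \<partial>M)"
    using assms by (rule moment_sequences_unit_intervalE)
  show ?thesis
    unfolding M(5) using M(3) by (intro integral_nonneg_AE) (auto elim: eventually_mono)
qed

text \<open>For \<open>x\<close> in \<open>[0,1]\<close> the power \<open>x ^ k\<close> is non-negative, so if it has integral zero it vanishes
  almost everywhere: the measure sits at \<open>0\<close> (or is zero, if \<open>k = 0\<close>).\<close>

lemma moment_sequences_vanish:
  assumes "s \<in> moment_sequences {0..1}" "s k = 0" "0 < j"
  shows "s j = 0"
proof -
  obtain M where M: "sets M = sets borel" "finite_measure M" "AE x in M. x \<in> {0..1}"
    "\<forall>k. integrable M (\<lambda>x. x ^ k)" "s = (\<lambda>k. \<integral>x. x ^ k \<partial>M)"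
    using assms(1) by (rule moment_sequences_unit_intervalE)
  have "AE x in M. 0 \<le> x ^ k"
    using M(3) by eventually_elim auto
  then have "AE x in M. x ^ k = 0"
    using integral_nonneg_eq_0_iff_AE[of M "\<lambda>x. x ^ k"] M(4) assms(2) unfolding M(5) by blast
  then have "AE x in M. x ^ j = 0"
    by eventually_elim (use \<open>0 < j\<close> in auto)
  then show ?thesis
    unfolding M(5) by (rule integral_eq_zero_AE)
qed

lemma moment_sequences_poly_nonneg:
  assumes "t \<in> moment_sequences {0..1}" and p: "\<And>z. z \<in> {0..1} \<Longrightarrow> 0 \<le> poly p z"
  shows "0 \<le> (\<Sum>i\<le>degree p. coeff p i * t i)"
proof -
  obtain M where M: "sets M = sets borel" "finite_measure M" "AE x in M. x \<in> {0..1}"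
    "\<forall>k. integrable M (\<lambda>x. x ^ k)" "t = (\<lambda>k. \<integral>x. x ^ k \<partial>M)"
    using assms(1) by (rule moment_sequences_unit_intervalE)
  have "(\<Sum>i\<le>degree p. coeff p i * t i) = (\<integral>x. poly p x \<partial>M)"
    unfolding M(5) poly_altdef using M(4) by (subst Bochner_Integration.integral_sum) auto
  also have "\<dots> \<ge> 0"
  proof (rule integral_nonneg_AE)
    show "AE x in M. 0 \<le> poly p x"
      using M(3) by eventually_elim (rule p)
  qed
  finally show ?thesis .
qed

section \<open>Absolutely monotonic functions as power series\<close>

lemma absolutely_monotonic_on_has_derivative:
  assumes "absolutely_monotonic_on I F" "x \<in> I"
  shows "((deriv ^^ k) F has_real_derivative (deriv ^^ Suc k) F x) (at x)"
  using assms
  by (auto simp: absolutely_monotonic_on_def smooth_on_open_def DERIV_deriv_iff_real_differentiable)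

lemma absolutely_monotonic_on_nonneg:
  assumes "absolutely_monotonic_on I F" "x \<in> I"
  shows "0 \<le> (deriv ^^ k) F x"
  using assms by (auto simp: absolutely_monotonic_on_def)

lemma absolutely_monotonic_on_deriv_mono_on:
  assumes "absolutely_monotonic_on I F" "is_interval I"
  shows "mono_on I ((deriv ^^ k) F)"
proof (rule mono_onI)
  fix x y assume xy: "x \<in> I" "y \<in> I" "x \<le> y"
  have "z \<in> I" if "x \<le> z" "z \<le> y" for z
    using assms(2) xy that unfolding is_interval_1 by blast
  then have "\<exists>d. ((deriv ^^ k) F has_real_derivative d) (at z) \<and> 0 \<le> d" if "x \<le> z" "z \<le> y" for z
    using that absolutely_monotonic_on_has_derivative[OF assms(1), of z k]
      absolutely_monotonic_on_nonneg[OF assms(1), of z "Suc k"] by blast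
  with xy(3) show "(deriv ^^ k) F x \<le> (deriv ^^ k) F y"
    by (rule DERIV_nonneg_imp_nondecreasing)
qed

lemma absolutely_monotonic_on_mono_on:
  assumes "absolutely_monotonic_on I F" "is_interval I"
  shows "mono_on I F"
  using absolutely_monotonic_on_deriv_mono_on[OF assms, of 0] by simp

text \<open>Lagrange's remainder is non-negative, and it grows when the intermediate point is moved to
  the right end point \<open>x\<close> because every derivative is non-decreasing.\<close>

lemma absolutely_monotonic_on_Taylor_bounds:
  fixes n :: nat
  assumes F: "absolutely_monotonic_on I F" and I: "is_interval I" "c \<in> I" "x \<in> I" and "c < x"
  defines "T \<equiv> \<Sum>m<n. (deriv ^^ m) F c / fact m * (x - c) ^ m"
  shows "T \<le> F x" "F x \<le> T + (deriv ^^ n) F x / fact n * (x - c) ^ n"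
proof -
  have sub: "z \<in> I" if "c \<le> z" "z \<le> x" for z
    using I that unfolding is_interval_1 by blast
  have "\<exists>t. c \<le> t \<and> t \<le> x \<and> F x = T + (deriv ^^ n) F t / fact n * (x - c) ^ n"
  proof (cases "n = 0")
    case True
    then show ?thesis
      using \<open>c < x\<close> by (intro exI[of _ x]) (simp add: T_def)
  next
    case False
    have "\<exists>t. c < t \<and> t < x \<and> F x = T + (deriv ^^ n) F t / fact n * (x - c) ^ n"
      unfolding T_def
    proof (rule Taylor_up[where a = c])
      show "\<forall>m t. m < n \<and> c \<le> t \<and> t \<le> x \<longrightarrow>
          ((deriv ^^ m) F has_real_derivative (deriv ^^ Suc m) F t) (at t)"
        using sub absolutely_monotonic_on_has_derivative[OF F] by blast
    qed (use False \<open>c < x\<close> in auto)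
    then show ?thesis
      by (meson less_imp_le)
  qed
  then obtain t where t: "t \<in> I" "t \<le> x" "F x = T + (deriv ^^ n) F t / fact n * (x - c) ^ n"
    using sub by meson
  have "0 \<le> (deriv ^^ n) F t" "(deriv ^^ n) F t \<le> (deriv ^^ n) F x"
    using absolutely_monotonic_on_nonneg[OF F t(1)]
      mono_onD[OF absolutely_monotonic_on_deriv_mono_on[OF F I(1)] t(1) \<open>x \<in> I\<close> t(2)] by auto
  then have "0 \<le> (deriv ^^ n) F t / fact n * (x - c) ^ n"
    "(deriv ^^ n) F t / fact n * (x - c) ^ n \<le> (deriv ^^ n) F x / fact n * (x - c) ^ n"
    using \<open>c < x\<close> by (auto intro!: mult_right_mono divide_right_mono)
  then show "T \<le> F x" "F x \<le> T + (deriv ^^ n) F x / fact n * (x - c) ^ n"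
    using t(3) by linarith+
qed

text \<open>Bernstein's theorem on a half-line. The derivatives are non-negative and non-decreasing, so they
  have limits at \<open>0\<close>, which serve as Taylor coefficients there. The remainder of the expansion of
  \<open>F x\<close> is at most \<open>F\<^sup>(\<^sup>n\<^sup>) (x) x\<^sup>n / n!\<close>, while the expansion of \<open>F (3 x)\<close> about \<open>x\<close> contains the
  term \<open>F\<^sup>(\<^sup>n\<^sup>) (x) (2 x)\<^sup>n / n!\<close> among non-negative ones. Hence the remainder is at most
  \<open>F (3 x) / 2\<^sup>n\<close>.\<close>

theorem absolutely_monotonic_power_series:
  assumes F: "absolutely_monotonic_on {0<..} F"
  shows "\<exists>a. (\<forall>n. 0 \<le> a n) \<and> (\<forall>x>0. (\<lambda>n. a n * x ^ n) sums F x)"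
proof -
  have int: "is_interval {0::real<..}"
    by (simp add: is_interval_1)
  have "\<exists>L\<ge>0. ((deriv ^^ n) F \<longlongrightarrow> L) (at_right 0) \<and> (\<forall>x>0. L \<le> (deriv ^^ n) F x)" for n
    by (intro mono_on_tendsto_at_right_0 absolutely_monotonic_on_deriv_mono_on[OF F int]
        absolutely_monotonic_on_nonneg[OF F]) auto
  then obtain A where A: "\<And>n. 0 \<le> A n" "\<And>n. ((deriv ^^ n) F \<longlongrightarrow> A n) (at_right 0)"
    by metis
  define a where "a n = A n / fact n" for n
  have "(\<lambda>n. a n * x ^ n) sums F x" if x: "x > 0" for x
  proof -
    have term_le: "(deriv ^^ n) F x / fact n * (2 * x) ^ n \<le> F (3 * x)" for n
    proof -
      have "(deriv ^^ n) F x / fact n * (3 * x - x) ^ n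
          \<le> (\<Sum>m<Suc n. (deriv ^^ m) F x / fact m * (3 * x - x) ^ m)"
        using x absolutely_monotonic_on_nonneg[OF F]
        by (intro member_le_sum) auto
      also have "\<dots> \<le> F (3 * x)"
        using x by (intro absolutely_monotonic_on_Taylor_bounds[OF F int]) auto
      finally show ?thesis
        by simp
    qed
    have bound: "\<bar>F x - (\<Sum>m<n. a m * x ^ m)\<bar> \<le> F (3 * x) / 2 ^ n" for n
    proof (rule tendsto_upperbound)
      have "((\<lambda>c. \<bar>F x - (\<Sum>m<n. (deriv ^^ m) F c / fact m * (x - c) ^ m)\<bar>)
          \<longlongrightarrow> \<bar>F x - (\<Sum>m<n. A m / fact m * (x - 0) ^ m)\<bar>) (at_right 0)"
        by (intro tendsto_intros A(2)) simp_all
      then show "((\<lambda>c. \<bar>F x - (\<Sum>m<n. (deriv ^^ m) F c / fact m * (x - c) ^ m)\<bar>)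
          \<longlongrightarrow> \<bar>F x - (\<Sum>m<n. a m * x ^ m)\<bar>) (at_right 0)"
        by (simp add: a_def)
      show "eventually (\<lambda>c. \<bar>F x - (\<Sum>m<n. (deriv ^^ m) F c / fact m * (x - c) ^ m)\<bar>
          \<le> F (3 * x) / 2 ^ n) (at_right 0)"
        using eventually_at_right_real[OF x]
      proof eventually_elim
        case (elim c)
        then have c: "0 < c" "c < x" by auto
        have "(deriv ^^ n) F x / fact n * (x - c) ^ n \<le> (deriv ^^ n) F x / fact n * x ^ n"
          using c x absolutely_monotonic_on_nonneg[OF F]
          by (intro mult_left_mono power_mono) auto
        also have "\<dots> \<le> F (3 * x) / 2 ^ n"
          using term_le[of n] by (simp add: field_simps)
        finally show ?case
          using absolutely_monotonic_on_Taylor_bounds[OF F int, of c x n] c x by auto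
      qed
    qed auto
    have "(\<lambda>n. F (3 * x) * (1 / 2) ^ n) \<longlonglongrightarrow> F (3 * x) * 0"
      by (intro tendsto_intros) auto
    then have "(\<lambda>n. F (3 * x) / 2 ^ n) \<longlonglongrightarrow> 0"
      by (simp add: power_one_over field_simps)
    then have "(\<lambda>n. F x - (\<Sum>m<n. a m * x ^ m)) \<longlonglongrightarrow> 0"
      by (rule Lim_null_comparison[rotated]) (use bound in auto)
    then have "(\<lambda>n. F x - (F x - (\<Sum>m<n. a m * x ^ m))) \<longlonglongrightarrow> F x - 0"
      by (intro tendsto_intros)
    then show ?thesis
      by (simp add: sums_def)
  qed
  moreover have "0 \<le> a n" for n
    by (simp add: a_def A)
  ultimately show ?thesis
    by blast
qed

section \<open>Absolutely monotonic functions preserve moment sequences\<close>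

text \<open>Dividing by the mass \<open>c = s 0\<close> turns \<open>F (s k)\<close> into the mixture of the sequences
  \<open>(s k / c) ^ n\<close> of moments of probability measures, with weights \<open>a n * c ^ n\<close> of sum \<open>F c\<close>.\<close>

lemma power_series_preserves_moment_sequences:
  assumes a: "\<And>n. 0 \<le> a n" and F: "\<And>x. 0 < x \<Longrightarrow> (\<lambda>n. a n * x ^ n) sums F x"
    and s: "s \<in> moment_sequences {0..1}" and pos: "\<And>k. 0 < s k"
  shows "entrywise F s \<in> moment_sequences {0..1}"
proof -
  define c where "c = s 0"
  have c: "c > 0"
    using pos by (simp add: c_def)
  have "(\<lambda>k. (1 / c) * s k) \<in> moment_sequences {0..1}"
    using c by (intro moment_sequences_scale s) auto
  then have "(\<lambda>k. ((1 / c) * s k) ^ n) \<in> moment_sequences {0..1}" for n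
    by (rule moment_sequences_power)
  moreover have "((1 / c) * s 0) ^ n = 1" for n
    using c by (simp add: c_def)
  moreover have "summable (\<lambda>n. a n * c ^ n)"
    using F[OF c] by (auto simp: sums_iff)
  ultimately have "(\<lambda>k. \<Sum>n. a n * c ^ n * ((1 / c) * s k) ^ n) \<in> moment_sequences {0..1}"
    using a c by (intro moment_sequences_mixture) auto
  moreover have "(\<Sum>n. a n * c ^ n * ((1 / c) * s k) ^ n) = F (s k)" for k
  proof -
    have "a n * c ^ n * ((1 / c) * s k) ^ n = a n * s k ^ n" for n
      using c by (simp add: power_divide)
    then show ?thesis
      by (simp only: sums_unique[OF F[OF pos]])
  qed
  ultimately show ?thesis
    by (simp add: entrywise_def)
qed

lemma absolutely_monotonic_preserves_moment_sequences:
  assumes F: "absolutely_monotonic_on {0<..} F" and "0 \<le> F 0"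
    and L: "(F \<longlongrightarrow> L) (at_right 0)" "F 0 \<le> L"
    and s: "s \<in> moment_sequences {0..1}"
  shows "entrywise F s \<in> moment_sequences {0..1}"
proof (cases "\<forall>k. s k \<noteq> 0")
  case True
  with moment_sequences_nonneg[OF s] have "0 < s k" for k
    by (simp add: less_le)
  then show ?thesis
    using absolutely_monotonic_power_series[OF F] power_series_preserves_moment_sequences s
    by metis
next
  case False
  then have s0: "s j = 0" if "j > 0" for j
    using moment_sequences_vanish[OF s] that by blast
  have "F 0 \<le> F (s 0)"
  proof (cases "s 0 = 0")
    case False
    then have pos: "0 < s 0"
      using moment_sequences_nonneg[OF s, of 0] by simp
    have "mono_on {0<..} F"
      using F by (rule absolutely_monotonic_on_mono_on) (simp add: is_interval_1)
    then have "F x \<le> F (s 0)" if "x \<in> {0<..<s 0}" for x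
      using that by (intro mono_onD[of "{0<..}" F]) auto
    then have "L \<le> F (s 0)"
      using eventually_at_right_real[OF pos]
      by (intro tendsto_upperbound[OF L(1)]) (auto elim: eventually_mono)
    with L(2) show ?thesis
      by simp
  qed simp
  then have "(\<lambda>k. F 0 + (F (s 0) - F 0) * 0 ^ k) \<in> moment_sequences {0..1}"
    using \<open>0 \<le> F 0\<close> by (intro moment_sequences_two_points) auto
  moreover have "F 0 + (F (s 0) - F 0) * 0 ^ k = F (s k)" for k
    using s0 by (cases "k = 0") auto
  ultimately show ?thesis
    by (simp add: entrywise_def)
qed

section \<open>Functions with non-negative forward differences\<close>

definition fwd_diff :: "real \<Rightarrow> (real \<Rightarrow> real) \<Rightarrow> real \<Rightarrow> real" where
  "fwd_diff h f = (\<lambda>u. f (u + h) - f u)"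

text \<open>The step is a parameter because the closure properties below hold for each step separately;
  differences with two different steps are only compared when one step is a multiple of the
  other.\<close>

definition diffs_nonneg :: "real \<Rightarrow> (real \<Rightarrow> real) \<Rightarrow> bool" where
  "diffs_nonneg h f \<longleftrightarrow> (\<forall>m u. 0 \<le> (fwd_diff h ^^ m) f u)"

definition all_diffs_nonneg :: "(real \<Rightarrow> real) \<Rightarrow> bool" where
  "all_diffs_nonneg f \<longleftrightarrow> (\<forall>h>0. diffs_nonneg h f)"

lemma fwd_diff_commute: "fwd_diff h (fwd_diff k f) = fwd_diff k (fwd_diff h f)"
  by (auto simp: fwd_diff_def algebra_simps)

lemma fwd_diff_funpow_commute:
  "(fwd_diff h ^^ m) (fwd_diff k f) = fwd_diff k ((fwd_diff h ^^ m) f)"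
  by (induction m) (simp_all add: fwd_diff_commute)

lemma fwd_diff_multiple:
  "fwd_diff (real n * h) f u = (\<Sum>i<n. fwd_diff h f (u + real i * h))"
proof -
  have "(\<Sum>i<n. f (u + real (Suc i) * h) - f (u + real i * h)) = f (u + real n * h) - f u"
    by (subst sum_lessThan_telescope) simp
  then show ?thesis
    by (simp add: fwd_diff_def algebra_simps)
qed

text \<open>A difference with step \<open>n h\<close> is a sum of translated differences with step \<open>h\<close>.\<close>

lemma diffs_nonneg_fwd_diff:
  assumes "diffs_nonneg h f"
  shows "diffs_nonneg h (fwd_diff (real n * h) f)"
proof -
  have "0 \<le> fwd_diff h ((fwd_diff h ^^ m) f) u" for m u
    using assms[unfolded diffs_nonneg_def, rule_format, of "Suc m" u] by simp
  then show ?thesis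
    by (auto simp: diffs_nonneg_def fwd_diff_funpow_commute fwd_diff_multiple intro!: sum_nonneg)
qed

lemma diffs_nonneg_funpow_fwd_diff:
  assumes "diffs_nonneg h f"
  shows "diffs_nonneg h ((fwd_diff (real n * h) ^^ m) f)"
  by (induction m) (use assms in \<open>auto intro: diffs_nonneg_fwd_diff\<close>)

text \<open>Non-negative differences of orders one and two, that is, monotonicity and midpoint convexity,
  already give continuity and convexity.\<close>

context
  fixes f :: "real \<Rightarrow> real"
  assumes f: "all_diffs_nonneg f"
begin

lemma all_diffs_nonnegD: "h > 0 \<Longrightarrow> 0 \<le> (fwd_diff h ^^ m) f u"
  using f by (auto simp: all_diffs_nonneg_def diffs_nonneg_def)

lemma all_diffs_nonneg_mono: "mono f"
proof (rule monoI)
  fix x y :: real assume "x \<le> y"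
  then show "f x \<le> f y"
    using all_diffs_nonnegD[of "y - x" 1 x] by (cases "x = y") (auto simp: fwd_diff_def)
qed

lemma all_diffs_nonneg_midpoint:
  assumes "h > 0"
  shows "2 * f u \<le> f (u - h) + f (u + h)"
  using all_diffs_nonnegD[OF assms, of 2 "u - h"]
  by (simp add: fwd_diff_def numeral_2_eq_2 algebra_simps)

text \<open>Midpoint convexity at least halves the increment whenever the step is halved.\<close>

lemma all_diffs_nonneg_halving:
  "f (u + 1 / 2 ^ n) - f u \<le> (f (u + 1) - f u) / 2 ^ n"
proof (induction n)
  case (Suc n)
  have "2 * f (u + 1 / 2 ^ Suc n) \<le> f u + f (u + 1 / 2 ^ n)"
  proof -
    have "u + 1 / 2 ^ Suc n + 1 / 2 ^ Suc n = u + 1 / 2 ^ n"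
      by simp
    with all_diffs_nonneg_midpoint[of "1 / 2 ^ Suc n" "u + 1 / 2 ^ Suc n"] show ?thesis
      by (simp del: power_Suc)
  qed
  moreover have "a - b \<le> d / 2" if "2 * a \<le> b + c" "c - b \<le> d" for a b c d :: real
    using that by linarith
  ultimately have "f (u + 1 / 2 ^ Suc n) - f u \<le> (f (u + 1) - f u) / 2 ^ n / 2"
    using Suc by blast
  then show ?case
    by simp
qed simp

text \<open>By halving, the increments of \<open>f\<close> over steps \<open>1 / 2 ^ n\<close> near \<open>v\<close> tend to zero; monotonicity
  transfers this to all nearby points.\<close>

lemma all_diffs_nonneg_isCont: "isCont f v"
proof -
  define C where "C = f (v + 1) - f (v - 1)"
  note mono = monoD[OF all_diffs_nonneg_mono]
  have near: "\<bar>f w - f v\<bar> \<le> C / 2 ^ n" if "\<bar>w - v\<bar> \<le> 1 / 2 ^ n" for w n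
  proof -
    have "(1::real) / 2 ^ n \<le> 1"
      by simp
    then have "f (v + 1) - f v \<le> C" "f (v - 1 / 2 ^ n + 1) - f (v - 1 / 2 ^ n) \<le> C"
      unfolding C_def by (intro diff_mono mono; simp)+
    then have "(f (v + 1) - f v) / 2 ^ n \<le> C / 2 ^ n"
      "(f (v - 1 / 2 ^ n + 1) - f (v - 1 / 2 ^ n)) / 2 ^ n \<le> C / 2 ^ n"
      by (auto intro!: divide_right_mono)
    with all_diffs_nonneg_halving[of v n] all_diffs_nonneg_halving[of "v - 1 / 2 ^ n" n]
    have "f (v + 1 / 2 ^ n) - f v \<le> C / 2 ^ n" "f v - f (v - 1 / 2 ^ n) \<le> C / 2 ^ n"
      by auto
    moreover have "f w \<le> f (v + 1 / 2 ^ n)" "f (v - 1 / 2 ^ n) \<le> f w"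
      using that by (intro mono; linarith)+
    ultimately show ?thesis
      by linarith
  qed
  have "(\<lambda>n. C * (1 / 2) ^ n) \<longlonglongrightarrow> C * 0"
    by (intro tendsto_intros) auto
  then have lim: "(\<lambda>n. C / 2 ^ n) \<longlonglongrightarrow> 0"
    by (simp add: power_one_over field_simps)
  show ?thesis
    unfolding continuous_at_eps_delta dist_real_def
  proof (intro allI impI)
    fix e :: real assume "e > 0"
    then obtain n where n: "C / 2 ^ n < e"
      using order_tendstoD(2)[OF lim] by (auto simp: eventually_sequentially)
    show "\<exists>d>0. \<forall>x'. \<bar>x' - v\<bar> < d \<longrightarrow> \<bar>f x' - f v\<bar> < e"
    proof (intro exI[of _ "1 / 2 ^ n"] conjI allI impI)
      fix w assume "\<bar>w - v\<bar> < 1 / 2 ^ n"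
      then show "\<bar>f w - f v\<bar> < e"
        using near[of w n] n by linarith
    qed simp
  qed
qed

lemma all_diffs_nonneg_convex: "convex_on UNIV f"
proof (rule convex_on_linorderI)
  fix t x y :: real
  assume t: "0 < t" "t < 1" and "x < y"
  define k where "k = (f y - f x) / (y - x)"
  define g where "g z = f z - (f x + k * (z - x))" for z
  have k: "k * (y - x) = f y - f x"
    using \<open>x < y\<close> by (simp add: k_def)
  then have gx: "g x = 0" and gy: "g y = 0"
    by (auto simp: g_def)
  have mid: "2 * g u \<le> g (u - h) + g (u + h)" if "h > 0" for u h
    using all_diffs_nonneg_midpoint[OF that, of u] by (simp add: g_def algebra_simps)
  have cont: "continuous_on A g" for A
    unfolding g_def
    by (intro continuous_intros continuous_at_imp_continuous_on ballI all_diffs_nonneg_isCont)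
  obtain c where c: "c \<in> {x..y}" "\<And>z. z \<in> {x..y} \<Longrightarrow> g z \<le> g c"
    using continuous_attains_sup[of "{x..y}" g] cont \<open>x < y\<close> by auto
  \<comment> \<open>At the rightmost maximum, midpoint convexity rules out an interior point.\<close>
  have "compact ({x..y} \<inter> g -` {g c})"
    by (intro compact_Int_closed) (auto intro!: continuous_closed_vimage continuous_on_imp_continuous_within simp: continuous_on_eq_continuous_within[symmetric] cont)
  then obtain d where d: "d \<in> {x..y}" "g d = g c"
    and d_max: "\<And>z. z \<in> {x..y} \<Longrightarrow> g z = g c \<Longrightarrow> z \<le> d"
    using compact_attains_sup[of "{x..y} \<inter> g -` {g c}"] c(1) by blast
  have "g c \<le> 0"
  proof (rule ccontr)
    assume "\<not> g c \<le> 0"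
    then have "x < d" "d < y"
      using d gx gy by (auto simp: less_le)
    then obtain h where h: "h > 0" "d - h \<in> {x..y}" "d + h \<in> {x..y}"
      by (intro that[of "min (d - x) (y - d)"]) auto
    have "g (d - h) \<le> g c" "g (d + h) < g c"
      using c(2)[of "d - h"] c(2)[of "d + h"] d_max[of "d + h"] h by (auto simp: less_le)
    with mid[OF h(1), of d] d show False
      by linarith
  qed
  moreover have "(1 - t) * x + t * y \<in> {x..y}"
    using t \<open>x < y\<close> convex_bound_le[of x y y "1 - t" t] mult_left_mono[of x y t]
    by (auto simp: algebra_simps)
  ultimately have "g ((1 - t) * x + t * y) \<le> 0"
    using c(2) by force
  moreover have "k * ((1 - t) * x + t * y - x) = t * (f y - f x)"
    unfolding k[symmetric] by (simp add: algebra_simps)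
  ultimately show "f ((1 - t) *\<^sub>R x + t *\<^sub>R y) \<le> (1 - t) * f x + t * f y"
    by (simp add: g_def algebra_simps)
qed auto

end

text \<open>By convexity, difference quotients decrease to a right derivative \<open>g\<close> as the step shrinks.
  Along steps \<open>h / n\<close> the differences of step \<open>h\<close> of these quotients are, up to a positive factor, sums of
  differences of step \<open>h / n\<close> of \<open>f\<close>, so \<open>g\<close> has non-negative differences too and is continuous. Since the slope
  of \<open>f\<close> between two points lies between the values of \<open>g\<close> at them, \<open>g\<close> is the two-sided derivative.\<close>

lemma all_diffs_nonneg_derivative:
  assumes f: "all_diffs_nonneg f"
  shows "\<exists>g. all_diffs_nonneg g \<and> (\<forall>u. (f has_real_derivative g u) (at u))"
proof -
  define q where "q u h = (f (u + h) - f u) / h" for u h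
  have slopes: "q u h \<le> q u k" if "0 < h" "h \<le> k" for u h k
    using convex_on_slope_le(1)[OF all_diffs_nonneg_convex[OF f], of u "u + k" "u + h"] that
    by (cases "h = k") (auto simp: q_def minus_divide_left)
  have slopes': "q u h \<le> q (u + h) k" if "0 < h" "0 < k" for u h k
  proof -
    have *: "(f u - f (u + h)) / (u - (u + h)) = q u h"
      "(f (u + h) - f (u + h + k)) / (u + h - (u + h + k)) = q (u + h) k"
      by (simp_all add: q_def minus_divide_left)
    have "q u h \<le> (f u - f (u + h + k)) / (u - (u + h + k))"
      using convex_on_slope_le(1)[OF all_diffs_nonneg_convex[OF f], of u "u + h + k" "u + h"] that *
      by simp
    also have "\<dots> \<le> q (u + h) k"
      using convex_on_slope_le(2)[OF all_diffs_nonneg_convex[OF f], of u "u + h + k" "u + h"] that *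
      by simp
    finally show ?thesis .
  qed
  have "\<exists>L\<ge>0. (q u \<longlongrightarrow> L) (at_right 0) \<and> (\<forall>h>0. L \<le> q u h)" for u
  proof (rule mono_on_tendsto_at_right_0)
    show "mono_on {0<..} (q u)"
      using slopes by (auto intro: mono_onI)
    show "0 \<le> q u h" if "0 < h" for h
      using that monoD[OF all_diffs_nonneg_mono[OF f], of u "u + h"] by (auto simp: q_def)
  qed
  then obtain g where g_lim: "\<And>u. (q u \<longlongrightarrow> g u) (at_right 0)"
    and g_le: "\<And>u h. h > 0 \<Longrightarrow> g u \<le> q u h"
    by metis
  \<comment> \<open>The slope of \<open>f\<close> over an interval is at most every slope starting at its right end.\<close>
  have g_ge: "q u h \<le> g (u + h)" if "h > 0" for u h
  proof (rule tendsto_lowerbound[OF g_lim])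
    show "eventually (\<lambda>k. q u h \<le> q (u + h) k) (at_right 0)"
      using eventually_at_right_less[of 0] by eventually_elim (use slopes' that in auto)
  qed auto
  have "all_diffs_nonneg g"
    unfolding all_diffs_nonneg_def diffs_nonneg_def
  proof (intro allI impI)
    fix h u :: real and m :: nat assume h: "h > 0"
    define \<delta> where "\<delta> n = h / real (Suc n)" for n
    have \<delta>: "\<delta> n > 0" "real (Suc n) * \<delta> n = h" for n
      using h by (auto simp: \<delta>_def)
    have "\<delta> \<longlonglongrightarrow> 0"
      unfolding \<delta>_def by (intro tendsto_divide_0[OF tendsto_const] filterlim_compose[OF filterlim_at_top_imp_at_infinity[OF filterlim_real_sequentially] filterlim_Suc])
    then have \<delta>_lim: "filterlim \<delta> (at_right 0) sequentially"
      using \<delta>(1) by (auto simp: filterlim_at less_imp_neq[symmetric])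
    have "(\<lambda>n. (fwd_diff h ^^ m) (\<lambda>u. q u (\<delta> n)) u) \<longlonglongrightarrow> (fwd_diff h ^^ m) g u"
    proof (induction m arbitrary: u)
      case 0
      then show ?case
        using filterlim_compose[OF g_lim \<delta>_lim] by (simp add: o_def)
    next
      case (Suc m)
      then show ?case
        by (auto simp: fwd_diff_def intro!: tendsto_diff)
    qed
    moreover have "0 \<le> (fwd_diff h ^^ m) (\<lambda>u. q u (\<delta> n)) u" for n
    proof -
      have "(fwd_diff h ^^ m) (\<lambda>u. q u (\<delta> n)) = (\<lambda>u. (fwd_diff h ^^ m) (fwd_diff (\<delta> n) f) u / \<delta> n)"
        by (induction m) (auto simp: q_def fwd_diff_def diff_divide_distrib)
      moreover have "diffs_nonneg (\<delta> n) ((fwd_diff (real (Suc n) * \<delta> n) ^^ m) (fwd_diff (real 1 * \<delta> n) f))"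
        using f \<delta> by (intro diffs_nonneg_funpow_fwd_diff diffs_nonneg_fwd_diff) (auto simp: all_diffs_nonneg_def)
      then have "0 \<le> (fwd_diff h ^^ m) (fwd_diff (\<delta> n) f) u"
        unfolding \<delta>(2) by (auto simp: diffs_nonneg_def dest: spec[of _ 0])
      ultimately show ?thesis
        using \<delta>(1)[of n] by simp
    qed
    ultimately show "0 \<le> (fwd_diff h ^^ m) g u"
      by (intro LIMSEQ_le_const) auto
  qed
  moreover have "(f has_real_derivative g u) (at u)" for u
  proof -
    have "isCont g u"
      using calculation by (rule all_diffs_nonneg_isCont)
    then have "((\<lambda>v. g v - g u) \<longlongrightarrow> 0) (at u)"
      by (simp add: isCont_def LIM_zero)
    then have "((\<lambda>v. (f v - f u) / (v - u) - g u) \<longlongrightarrow> 0) (at u)"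
    proof (rule Lim_transform_bound[rotated])
      have "\<bar>(f v - f u) / (v - u) - g u\<bar> \<le> \<bar>g v - g u\<bar>" if "v \<noteq> u" for v
      proof (cases "u < v")
        case True
        then show ?thesis
          using g_le[of "v - u" u] g_ge[of "v - u" u] by (simp add: q_def)
      next
        case False
        then have "(f v - f u) / (v - u) = q v (u - v)"
          using that by (simp add: q_def field_simps)
        then show ?thesis
          using False that g_le[of "u - v" v] g_ge[of "u - v" v] by simp
      qed
      then show "eventually (\<lambda>v. norm ((f v - f u) / (v - u) - g u) \<le> norm (g v - g u)) (at u)"
        by (auto simp: eventually_at_filter)
    qed
    then show ?thesis
      by (simp add: has_field_derivative_iff LIM_zero_iff)
  qed
  ultimately show ?thesis
    by blast
qed

section \<open>Smoothness of a preserver\<close>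

text \<open>The forward difference of order \<open>m\<close> is the integral of \<open>(1 - x) ^ m\<close>. Here \<open>t\<close> samples \<open>f\<close>
  backwards from \<open>v\<close>, as for an atom at \<open>exp (- h)\<close>.\<close>

lemma moment_sequences_fwd_diff_nonneg:
  assumes "t \<in> moment_sequences {0..1}" and t: "\<And>k. t k = f (v - real k * h)"
  shows "0 \<le> (fwd_diff h ^^ m) f (v - real m * h)"
proof -
  obtain M where M: "sets M = sets borel" "finite_measure M" "AE x in M. x \<in> {0..1}"
    "\<forall>k. integrable M (\<lambda>x. x ^ k)" "t = (\<lambda>k. \<integral>x. x ^ k \<partial>M)"
    using assms(1) by (rule moment_sequences_unit_intervalE)
  have int: "integrable M (\<lambda>x. x ^ k * (1 - x) ^ m)" for k m
  proof (induction m arbitrary: k)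
    case (Suc m)
    have "integrable M (\<lambda>x. x ^ k * (1 - x) ^ m - x ^ Suc k * (1 - x) ^ m)"
      by (intro Bochner_Integration.integrable_diff Suc)
    then show ?case
      by (simp add: algebra_simps)
  qed (use M(4) in simp)
  have "(fwd_diff h ^^ m) f (v - real (k + m) * h) = (\<integral>x. x ^ k * (1 - x) ^ m \<partial>M)" for k
  proof (induction m arbitrary: k)
    case 0
    then show ?case
      using t[of k] by (simp add: M(5))
  next
    case (Suc m)
    have "(fwd_diff h ^^ Suc m) f (v - real (k + Suc m) * h)
        = (fwd_diff h ^^ m) f (v - real (k + m) * h) - (fwd_diff h ^^ m) f (v - real (Suc k + m) * h)"
      by (simp add: fwd_diff_def algebra_simps)
    also have "\<dots> = (\<integral>x. x ^ k * (1 - x) ^ m - x ^ Suc k * (1 - x) ^ m \<partial>M)"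
      unfolding Suc by (rule Bochner_Integration.integral_diff[symmetric]) (rule int)+
    also have "\<dots> = (\<integral>x. x ^ k * (1 - x) ^ Suc m \<partial>M)"
      by (simp add: algebra_simps)
    finally show ?case .
  qed
  from this[of 0] have "(fwd_diff h ^^ m) f (v - real m * h) = (\<integral>x. x ^ 0 * (1 - x) ^ m \<partial>M)"
    by simp
  also have "\<dots> \<ge> 0"
    using M(3) by (intro integral_nonneg_AE) (auto elim: eventually_mono)
  finally show ?thesis .
qed

text \<open>A function is smooth if it lies in a class in which every member has a
  derivative belonging to the class. Only values
  in \<open>I\<close> are compared, since the iterates of \<open>deriv\<close> are arbitrary elsewhere.\<close>

lemma smooth_on_open_coinduct:
  assumes "open I" and "f \<in> C"
    and step: "\<And>g. g \<in> C \<Longrightarrow> \<exists>g'\<in>C. \<forall>x\<in>I. (g has_real_derivative g' x) (at x)"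
  shows "smooth_on_open I f"
proof -
  have transfer: "(f has_real_derivative D) (at x)"
    if "(g has_real_derivative D) (at x)" "\<forall>x\<in>I. f x = g x" "x \<in> I" for f g D x
    using that has_field_derivative_transform_within_open[OF that(1) \<open>open I\<close> that(3), of f] by simp
  have "\<exists>g\<in>C. \<forall>x\<in>I. (deriv ^^ k) f x = g x" for k
  proof (induction k)
    case 0
    show ?case
      using \<open>f \<in> C\<close> by auto
  next
    case (Suc k)
    then obtain g where g: "g \<in> C" "\<forall>x\<in>I. (deriv ^^ k) f x = g x"
      by blast
    with step obtain g' where "g' \<in> C" "\<forall>x\<in>I. (g has_real_derivative g' x) (at x)"
      by blast
    with transfer[OF _ g(2)] show ?case
      by (auto intro!: DERIV_imp_deriv bexI[of _ g'])
  qed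
  then show ?thesis
    unfolding smooth_on_open_def using step transfer by (metis real_differentiable_def)
qed

text \<open>The functions \<open>x \<mapsto> e (ln x) / x ^ k\<close> with smooth \<open>e\<close> form a class closed under differentiation:
  the derivative is \<open>(e' - k e) (ln x) / x ^ (k + 1)\<close>. A sequence whose members are successive
  derivatives of each other stands for the smooth function \<open>e\<close>.\<close>

lemma smooth_on_open_of_smooth_comp_exp:
  assumes d0: "d 0 = (\<lambda>u. F (exp u))"
    and d: "\<And>n u. (d n has_real_derivative d (Suc n) u) (at u)"
  shows "smooth_on_open {0<..} F"
proof (rule smooth_on_open_coinduct)
  let ?I = "{0::real<..}"
  let ?C = "{g. \<exists>(k::nat) e. (\<forall>n u. (e n has_real_derivative e (Suc n) u) (at u)) \<and>
      (\<forall>x\<in>?I. g x = exp (- real k * ln x) * e 0 (ln x))}"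
  show "open ?I"
    by simp
  show "F \<in> ?C"
    using d d0 by (intro CollectI exI[of _ 0] exI[of _ d]) simp
  fix g assume "g \<in> ?C"
  then obtain k :: nat and e where e: "\<And>n u. (e n has_real_derivative e (Suc n) u) (at u)"
    and g: "\<And>x. x \<in> ?I \<Longrightarrow> g x = exp (- real k * ln x) * e 0 (ln x)"
    by blast
  define e' where "e' n u = e (Suc n) u - real k * e n u" for n u
  define g' where "g' x = exp (- real (Suc k) * ln x) * e' 0 (ln x)" for x
  have "(e' n has_real_derivative e' (Suc n) u) (at u)" for n u
    unfolding e'_def by (auto intro!: derivative_eq_intros e)
  then have "g' \<in> ?C"
    unfolding g'_def by blast
  moreover have "(g has_real_derivative g' x) (at x)" if x: "x \<in> ?I" for x
  proof -
    have "exp (- real (Suc k) * ln x) = exp (- real k * ln x) / x"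
      using x by (simp add: distrib_right exp_diff exp_minus field_simps flip: exp_add)
    then have g'_eq: "g' x = exp (- real k * ln x) / x * (e 1 (ln x) - real k * e 0 (ln x))"
      by (simp add: g'_def e'_def)
    have "((\<lambda>x. exp (- real k * ln x) * e 0 (ln x)) has_real_derivative g' x) (at x)"
      using x unfolding g'_eq
      by (auto intro!: derivative_eq_intros DERIV_chain2[OF e] simp: field_simps)
    then show ?thesis
      using has_field_derivative_transform_within_open[of _ "g' x" x ?I g] g x by simp
  qed
  ultimately show "\<exists>g'\<in>?C. \<forall>x\<in>?I. (g has_real_derivative g' x) (at x)"
    by blast
qed

lemma all_diffs_nonneg_exp_imp_smooth:
  assumes "all_diffs_nonneg (\<lambda>u. F (exp u))"
  shows "smooth_on_open {0<..} F"
proof -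
  have "\<exists>d. \<forall>n. (all_diffs_nonneg (d n) \<and> (n = 0 \<longrightarrow> d n = (\<lambda>u. F (exp u)))) \<and>
      (\<forall>u. (d n has_real_derivative d (Suc n) u) (at u))"
    using assms all_diffs_nonneg_derivative by (intro dependent_nat_choice) auto
  then show ?thesis
    using smooth_on_open_of_smooth_comp_exp by metis
qed

section \<open>Positivity of the derivatives of a preserver\<close>

text \<open>Let \<open>G 0 h = \<Sum>i. p\<^sub>i F (a + h x\<^sup>i)\<close>. Its \<open>j\<close>-th derivative at \<open>h = 0\<close> is \<open>p (x\<^sup>j)\<close> times that of
  \<open>F\<close> at \<open>a\<close>. With \<open>p = \<Prod>j<N. (z - x\<^sup>j)\<^sup>2\<close> the derivatives of order below \<open>N\<close> vanish, so the
  non-negativity of \<open>G 0\<close> for \<open>h \<ge> 0\<close> decides the sign of the \<open>N\<close>-th.\<close>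

lemma moment_preserver_deriv_nonneg:
  assumes F: "\<And>s. s \<in> moment_sequences {0..1} \<Longrightarrow> entrywise F s \<in> moment_sequences {0..1}"
    and smooth: "smooth_on_open {0<..} F" and "0 < a"
  shows "0 \<le> (deriv ^^ N) F a"
proof -
  \<comment> \<open>Any \<open>x\<close> strictly between 0 and 1 would do: its powers have to be distinct and in \<open>[0,1]\<close>.\<close>
  define x :: real where "x = 1 / 2"
  define p where "p = (\<Prod>j<N. [:- (x ^ j), 1:] ^ 2)"
  have p: "poly p z = (\<Prod>j<N. (z - x ^ j) ^ 2)" for z
    by (simp add: p_def poly_prod)
  define G where "G j h = (\<Sum>i\<le>degree p. coeff p i * (x ^ i) ^ j * (deriv ^^ j) F (a + h * x ^ i))"
    for j h
  have G_deriv: "(G j has_real_derivative G (Suc j) h) (at h)" if "0 \<le> h" for j h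
  proof -
    have "((deriv ^^ j) F has_real_derivative (deriv ^^ Suc j) F (a + h * x ^ i)) (at (a + h * x ^ i))" for i
      using smooth \<open>0 < a\<close> that
      by (auto simp: smooth_on_open_def DERIV_deriv_iff_real_differentiable x_def add_pos_nonneg)
    then have "((\<lambda>h. (deriv ^^ j) F (a + h * x ^ i)) has_real_derivative
        (deriv ^^ Suc j) F (a + h * x ^ i) * x ^ i) (at h)" for i
      by (rule DERIV_chain2) (auto intro!: derivative_eq_intros)
    then have "((\<lambda>h. coeff p i * (x ^ i) ^ j * (deriv ^^ j) F (a + h * x ^ i)) has_real_derivative
        coeff p i * (x ^ i) ^ j * ((deriv ^^ Suc j) F (a + h * x ^ i) * x ^ i)) (at h)" for i
      by (rule DERIV_cmult)
    then show ?thesis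
      unfolding G_def by (auto intro!: DERIV_sum simp: mult_ac)
  qed
  have G_0: "G j 0 = poly p (x ^ j) * (deriv ^^ j) F a" for j
    by (simp add: G_def poly_altdef sum_distrib_left sum_distrib_right mult_ac flip: power_mult)
  have G_nonneg: "0 \<le> G 0 h" if "0 \<le> h" for h
  proof -
    have "(\<lambda>k. a + h * x ^ k) \<in> moment_sequences {0..1}"
      using that \<open>0 < a\<close> by (intro moment_sequences_two_points) (auto simp: x_def)
    from moment_sequences_poly_nonneg[OF F[OF this], of p] show ?thesis
      by (simp add: G_def entrywise_def p prod_nonneg)
  qed
  have "\<exists>\<xi>. 0 < \<xi> \<and> \<xi> \<le> h \<and> 0 \<le> G N \<xi>" if h: "0 < h" for h
  proof -
    obtain \<xi> where \<xi>: "0 < \<xi>" "\<xi> \<le> h"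
      "G 0 h = (\<Sum>m<N. G m 0 / fact m * h ^ m) + G N \<xi> / fact N * h ^ N"
      using Maclaurin2[OF h, of G "G 0" N] G_deriv by auto
    have "G m 0 = 0" if "m < N" for m
      using that by (auto simp: G_0 p)
    then have "G 0 h = G N \<xi> * (h ^ N / fact N)"
      using \<xi>(3) by simp
    moreover have "0 < h ^ N / fact N"
      using h by simp
    ultimately have "0 \<le> G N \<xi>"
      using G_nonneg[of h] h mult_neg_pos[of "G N \<xi>" "h ^ N / fact N"] by linarith
    with \<xi> show ?thesis
      by blast
  qed
  note near = this
  have "0 \<le> G N 0"
  proof (rule ccontr)
    assume "\<not> 0 \<le> G N 0"
    moreover have "(G N \<longlongrightarrow> G N 0) (at_right 0)"
      using DERIV_isCont[OF G_deriv[of 0 N]] by (simp add: isCont_def filterlim_at_split)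
    ultimately have "eventually (\<lambda>h. G N h < 0) (at_right 0)"
      using order_tendstoD(2) by fastforce
    then obtain b where b: "b > 0" "\<And>h. 0 < h \<Longrightarrow> h < b \<Longrightarrow> G N h < 0"
      by (auto simp: eventually_at_right_field)
    with near[of "b / 2"] show False
      by force
  qed
  moreover have "0 < poly p (x ^ N)"
    unfolding p by (intro prod_pos) (auto simp: x_def power_inject_exp' )
  ultimately show ?thesis
    by (simp add: G_0 zero_le_mult_iff)
qed

section \<open>The characterisation\<close>

theorem theorem3p2:
  fixes F :: "real \<Rightarrow> real"
  shows "(entrywise F ` moment_sequences {0..1} \<subseteq> moment_sequences {0..1} \<longleftrightarrow>
           absolutely_monotonic_on {0<..} F \<and> 0 \<le> F 0 \<and>
           (\<exists>L. (F \<longlongrightarrow> L) (at_right 0) \<and> F 0 \<le> L)) \<and>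
         (absolutely_monotonic_on {0<..} F \<longrightarrow> mono_on {0<..} F)"
proof (intro conjI impI iffI)
  show mono: "mono_on {0<..} F" if "absolutely_monotonic_on {0<..} F"
    using that by (rule absolutely_monotonic_on_mono_on) (simp add: is_interval_1)
  {
    assume "absolutely_monotonic_on {0<..} F \<and> 0 \<le> F 0 \<and>
      (\<exists>L. (F \<longlongrightarrow> L) (at_right 0) \<and> F 0 \<le> L)"
    then show "entrywise F ` moment_sequences {0..1} \<subseteq> moment_sequences {0..1}"
      using absolutely_monotonic_preserves_moment_sequences by blast
  }
  assume "entrywise F ` moment_sequences {0..1} \<subseteq> moment_sequences {0..1}"
  then have F: "\<And>s. s \<in> moment_sequences {0..1} \<Longrightarrow> entrywise F s \<in> moment_sequences {0..1}"
    by blast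
  have two: "(\<lambda>k. F (a + b * x ^ k)) \<in> moment_sequences {0..1}"
    if "0 \<le> a" "0 \<le> b" "x \<in> {0..1}" for a b x
    using F[OF moment_sequences_two_points[OF that]] by (simp add: entrywise_def)
  \<comment> \<open>The atom of mass \<open>exp (u + m h)\<close> at \<open>exp (- h)\<close> has moments \<open>exp (u + m h - k h)\<close>.\<close>
  have "0 \<le> (fwd_diff h ^^ m) (\<lambda>u. F (exp u)) u" if "h > 0" for h m u
  proof -
    have "F (0 + exp (u + real m * h) * exp (- h) ^ k) = F (exp (u + real m * h - real k * h))" for k
      by (simp add: exp_diff exp_minus exp_of_nat2_mult field_simps)
    then show ?thesis
      using moment_sequences_fwd_diff_nonneg[OF two[of 0 "exp (u + real m * h)" "exp (- h)"],
          where f = "\<lambda>u. F (exp u)" and v = "u + real m * h" and h = h and m = m] that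
      by simp
  qed
  then have "all_diffs_nonneg (\<lambda>u. F (exp u))"
    by (simp add: all_diffs_nonneg_def diffs_nonneg_def)
  then have smooth: "smooth_on_open {0<..} F"
    by (rule all_diffs_nonneg_exp_imp_smooth)
  then show am: "absolutely_monotonic_on {0<..} F"
    using moment_preserver_deriv_nonneg[OF F] by (simp add: absolutely_monotonic_on_def)
  show "0 \<le> F 0"
    using moment_sequences_nonneg[OF two[of 0 0 0], of 0] by simp
  \<comment> \<open>The image of \<open>(c, 0, 0, \<dots>)\<close> decreases from its first entry to its second.\<close>
  have F0_le: "F 0 \<le> F c" if "c > 0" for c
    using moment_sequences_poly_nonneg[OF two[of 0 c 0], of "[:1, -1:]"] that by simp
  \<comment> \<open>Only values on \<open>(0,\<infinity>)\<close> matter for the limit; there \<open>F\<close> is bounded below by \<open>F 0\<close>.\<close>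
  obtain L where L: "(F \<longlongrightarrow> L) (at_right 0)"
    using mono_on_tendsto_at_right_0[OF mono[OF am]] \<open>0 \<le> F 0\<close> F0_le by force
  moreover have "F 0 \<le> L"
    using eventually_at_right_less[of "0::real"] F0_le
    by (intro tendsto_lowerbound[OF L]) (auto elim: eventually_mono)
  ultimately show "\<exists>L. (F \<longlongrightarrow> L) (at_right 0) \<and> F 0 \<le> L"
    by blast
qed

end
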